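(* If $j$ and $n$ are integers such that $1 \leq j \leq n$, then $$\sum_{k=0}^{j} \binom{n}{k} = 1 + \left( \left\lfloor \frac{1 - (2^n+1)^n}{(2^n-1)\, 2^{nj}} \right\rfloor \bmod 2^n \right).$$
   Context: For a (possibly negative) integer $a$ and a positive integer $b$, $a \bmod b$ denotes the remainder $a - b\lfloor a/b \rfloor \in \{0, \ldots, b-1\}$. The subtraction in $1 - (2^n+1)^n$ is the usual (not truncated) subtraction of integers, the quotient is a rational number, and $\lfloor \cdot \rfloor$ is the usual floor function (greatest integer not exceeding the argument, also for negative arguments). *)

theory Defs imports Complex_Main begin

end

theory Submission imports Defs begin

text \<open>
  Put \<open>x = 2 ^ n\<close> and let \<open>S i\<close> be the sum of the binomial coefficients
  \<open>n choose k\<close> with \<open>k \<le> i\<close>. Summation by parts gives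
  \<open>(1 - (x + 1) ^ n) / (x - 1) = (\<Sum>i\<le>n. (S i - 1) * x ^ i) - x ^ (n + 1)\<close>.
  As \<open>1 \<le> S i \<le> x\<close>, the numbers \<open>S i - 1\<close> are base \<open>x\<close> digits, and the expression in the theorem
  extracts the digit with index \<open>j\<close>; the negative term only affects digits with index above \<open>n\<close>.
\<close>

text \<open>Dividing by \<open>x\<close> drops the digit \<open>d 0\<close> and shifts the others
  down, whence the induction on \<open>j\<close>. Bounding \<open>d i\<close> for every
  \<open>i\<close> lets the shifted sequence inherit the bounds. As \<open>div\<close> rounds down,
  \<open>c\<close> may be negative.\<close>

lemma digit_extraction:
  fixes x c :: int and d :: "nat \<Rightarrow> int"
  assumes "\<And>i. 0 \<le> d i" and "\<And>i. d i < x" and "j \<le> n"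
  shows "((\<Sum>i\<le>n. d i * x ^ i) + c * x ^ Suc n) div x ^ j mod x = d j"
  using assms
proof (induction j arbitrary: n d)
  case 0
  have "(\<Sum>i\<le>n. d i * x ^ i) + c * x ^ Suc n
      = d 0 + x * ((\<Sum>i<n. d (Suc i) * x ^ i) + c * x ^ n)"
    by (simp add: sum.atMost_shift sum_distrib_left algebra_simps)
  then show ?case
    using 0 by simp
next
  case (Suc j)
  then obtain m where n: "n = Suc m"
    by (cases n) auto
  have x: "0 < x"
    using Suc.prems(1,2)[of 0] by linarith
  have "(\<Sum>i\<le>n. d i * x ^ i) + c * x ^ Suc n
      = d 0 + x * ((\<Sum>i\<le>m. d (Suc i) * x ^ i) + c * x ^ Suc m)"
    unfolding n
    by (subst sum.atMost_Suc_shift) (simp add: sum_distrib_left algebra_simps)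
  moreover have "d 0 div x = 0"
    using Suc.prems(1,2)[of 0] by simp
  ultimately have "((\<Sum>i\<le>n. d i * x ^ i) + c * x ^ Suc n) div x
      = (\<Sum>i\<le>m. d (Suc i) * x ^ i) + c * x ^ Suc m"
    using x by simp
  moreover have "a div x ^ Suc j = a div x div x ^ j" for a
    using x by (simp add: zdiv_zmult2_eq)
  ultimately show ?case
    using Suc.IH[of "\<lambda>i. d (Suc i)" m] Suc.prems n by simp
qed

text \<open>The product telescopes: for \<open>0 < i\<close> and \<open>i \<le> m\<close>, the
  coefficient of \<open>x ^ i\<close> is a difference of consecutive partial sums, namely
  \<open>- b i\<close>.\<close>

lemma sum_partial_sums_mult_power:
  fixes x :: "'a::comm_ring_1" and b :: "nat \<Rightarrow> 'a"
  shows "(x - 1) * (\<Sum>i\<le>m. (\<Sum>k\<le>i. b k) * x ^ i)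
    = x ^ Suc m * (\<Sum>k\<le>m. b k) - (\<Sum>k\<le>m. b k * x ^ k)"
  by (induction m) (simp_all add: algebra_simps)

text \<open>The choice of \<open>x\<close> as the full row sum makes the top term
  \<open>x ^ Suc n * x\<close>, which cancels against the geometric sum and
  \<open>(x - 1) * x ^ Suc n\<close> up to the constant 1.\<close>

lemma sum_binomial_partial_sums_mult_power:
  fixes x :: "'a::comm_ring_1"
  assumes "x = 2 ^ n"
  shows "(x - 1) * ((\<Sum>i\<le>n. ((\<Sum>k\<le>i. of_nat (n choose k)) - 1) * x ^ i) - x ^ Suc n)
    = 1 - (x + 1) ^ n"
proof -
  have total: "(\<Sum>k\<le>n. of_nat (n choose k) :: 'a) = x"
    using assms choose_row_sum[of n] by (metis of_nat_numeral of_nat_power of_nat_sum)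
  have binom: "(\<Sum>k\<le>n. of_nat (n choose k) * x ^ k) = (x + 1) ^ n"
    by (simp add: binomial_ring)
  have geom: "(x - 1) * (\<Sum>i\<le>n. x ^ i) = x ^ Suc n - 1"
    by (simp add: power_diff_1_eq lessThan_Suc_atMost del: power_Suc)
  have "(x - 1) * ((\<Sum>i\<le>n. ((\<Sum>k\<le>i. of_nat (n choose k)) - 1) * x ^ i) - x ^ Suc n)
      = (x - 1) * (\<Sum>i\<le>n. (\<Sum>k\<le>i. of_nat (n choose k)) * x ^ i)
        - (x - 1) * (\<Sum>i\<le>n. x ^ i) - (x - 1) * x ^ Suc n"
    by (simp add: left_diff_distrib sum_subtractf right_diff_distrib)
  then show ?thesis
    unfolding sum_partial_sums_mult_power total binom geom by (simp add: algebra_simps)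
qed

theorem theorem3p2:
  fixes j n :: nat
  assumes "1 \<le> j" and "j \<le> n"
  shows "(\<Sum>k = 0..j. int (n choose k)) =
    1 + \<lfloor>(1 - (2 ^ n + 1) ^ n :: rat) / ((2 ^ n - 1) * 2 ^ (n * j))\<rfloor> mod 2 ^ n"
proof -
  define x :: int where "x = 2 ^ n"
  define d where "d i = (\<Sum>k\<le>i. int (n choose k)) - 1" for i
  define N where "N = (\<Sum>i\<le>n. d i * x ^ i) - x ^ Suc n"
  \<comment> \<open>The bounds on \<open>j\<close> force \<open>n\<close> to be positive, so the
    factor \<open>x - 1\<close> can be cancelled.\<close>
  have "(1::int) < 2 ^ n"
    using assms by (intro one_less_power) auto
  then have x1: "x - 1 \<noteq> 0"
    by (simp add: x_def)
  have lower: "0 \<le> d i" for i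
    using sum_mono2[of "{..i}" "{0}" "\<lambda>k. int (n choose k)"] by (simp add: d_def)
  have upper: "d i < x" for i
  proof -
    \<comment> \<open>The maximum also covers \<open>i\<close> above \<open>n\<close>, where the
      additional binomial coefficients vanish.\<close>
    have "(\<Sum>k\<le>i. n choose k) \<le> (\<Sum>k\<le>max i n. n choose k)"
      by (rule sum_mono2) auto
    also have "\<dots> = (\<Sum>k\<le>n. n choose k)"
      by (rule sum.mono_neutral_right) auto
    finally have "(\<Sum>k\<le>i. n choose k) \<le> 2 ^ n"
      by (simp add: choose_row_sum)
    then have "int (\<Sum>k\<le>i. n choose k) \<le> int (2 ^ n)"
      by (simp only: of_nat_le_iff)
    then show ?thesis
      by (simp add: d_def x_def)
  qed
  have N: "(x - 1) * N = 1 - (x + 1) ^ n"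
    unfolding N_def d_def using sum_binomial_partial_sums_mult_power[OF x_def] by simp
  have "(1 - (2 ^ n + 1) ^ n :: rat) / ((2 ^ n - 1) * 2 ^ (n * j))
      = of_int (1 - (x + 1) ^ n) / of_int ((x - 1) * x ^ j)"
    by (simp add: x_def power_mult)
  \<comment> \<open>The floor of a quotient of integers is \<open>div\<close>, also for this
    negative numerator.\<close>
  then have "\<lfloor>(1 - (2 ^ n + 1) ^ n :: rat) / ((2 ^ n - 1) * 2 ^ (n * j))\<rfloor>
      = ((x - 1) * N) div ((x - 1) * x ^ j)"
    by (simp only: floor_divide_of_int_eq N)
  also have "\<dots> = N div x ^ j"
    using x1 by simp
  finally have "\<lfloor>(1 - (2 ^ n + 1) ^ n :: rat) / ((2 ^ n - 1) * 2 ^ (n * j))\<rfloor> mod 2 ^ n = d j"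
    using digit_extraction[of d x j n "-1", OF lower upper assms(2)] by (simp add: N_def x_def)
  then show ?thesis
    by (simp add: d_def atMost_atLeast0)
qed

end
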